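(* Let $k$ be a field, $R = k[x_1,\dots,x_d]$, and $\mathfrak m = (x_1,\dots,x_d)$. Let $I \subseteq R$ be a square-free monomial ideal, and assume that every proper minor of $I$ is normally torsion-free. If $\mathfrak m \in \operatorname{Ass}(R/I^t)$ (where $t$ is a positive integer), then $t \ge \beta_1(I)+1$.
   Context: Normally torsion-free: an ideal $I$ of a Noetherian ring $R$ is normally torsion-free if $\operatorname{Ass}(R/I^t) = \operatorname{Ass}(R/I)$ for all $t \ge 1$. Minors: let $I \subseteq k[x_1,\dots,x_d]$ be a square-free monomial ideal and $x$ one of the variables. The deletion of $x$ is the ideal, in the polynomial ring on the remaining variables, generated by the images of the generators of $I$ after setting $x=0$ (i.e. by the minimal monomial generators of $I$ not divisible by $x$). The contraction of $x$ is the ideal, in the polynomial ring on the remaining variables, generated by the images of the generators of $I$ after setting $x=1$. A minor of $I$ is an ideal obtained from $I$ by a sequence of deletions and contractions; it is proper if at least one deletion or contraction is performed. $\beta_1(I)$: the maximum cardinality of a set of minimal monomial generators of $I$ with pairwise disjoint supports (no two share a variable). Equivalently, it is the monomial grade of $I$ (maximum length of a regular sequence of monomials in $I$), and the matching number of the hypergraph whose edges are the supports of the minimal generators of $I$.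
   Formalization: The formal theorem additionally assumes that I is not the ideal m = (x_1,...,x_d) itself; without this the claim fails, e.g. for I = (x) in k[x] and t = 1, where m is associated to R/I but beta_1(I) + 1 = 2. *)

theory Defs
  imports "HOL-Library.Poly_Mapping" "HOL-Algebra.QuotRing" "HOL-Algebra.Ideal_Product"
begin

section \<open>Polynomial rings in finitely many variables\<close>

text \<open>
  A polynomial is a finitely supported map from exponent vectors to coefficients. All variables
  \<open>x\<^sub>i\<close> (\<open>i :: nat\<close>) live in one type, and the ring \<open>k[x\<^sub>i | i \<in> V]\<close> is singled out by its carrier,
  because deletions and contractions pass to polynomial rings in fewer variables.
\<close>

type_synonym expo = "nat \<Rightarrow>\<^sub>0 nat"
type_synonym 'k mpoly = "expo \<Rightarrow>\<^sub>0 'k"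

abbreviation keys :: "('a \<Rightarrow>\<^sub>0 'b::zero) \<Rightarrow> 'a set" where
  "keys \<equiv> Poly_Mapping.keys"

abbreviation lookup :: "('a \<Rightarrow>\<^sub>0 'b::zero) \<Rightarrow> 'a \<Rightarrow> 'b" where
  "lookup \<equiv> Poly_Mapping.lookup"

definition poly_ring :: "nat set \<Rightarrow> ('k::field) mpoly ring" where
  "poly_ring V =
     \<lparr>carrier = {p. \<forall>m\<in>keys p. keys m \<subseteq> V}, mult = (*), one = 1, zero = 0, add = (+)\<rparr>"

definition mon :: "expo \<Rightarrow> ('k::field) mpoly" where
  "mon m = Poly_Mapping.single m 1"

definition max_hom_ideal :: "nat set \<Rightarrow> ('k::field) mpoly set" where
  "max_hom_ideal V = Idl\<^bsub>poly_ring V\<^esub> ((\<lambda>i. mon (Poly_Mapping.single i 1)) ` V)"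

lemma cring_poly_ring: "cring (poly_ring V :: ('k::field) mpoly ring)"
proof (rule cringI)
  show "abelian_group (poly_ring V :: 'k mpoly ring)"
  proof (rule abelian_groupI)
    fix p :: "'k mpoly" assume p: "p \<in> carrier (poly_ring V)"
    then have "- p \<in> carrier (poly_ring V)"
      by (simp add: poly_ring_def)
    then show "\<exists>q\<in>carrier (poly_ring V). q \<oplus>\<^bsub>poly_ring V\<^esub> p = \<zero>\<^bsub>poly_ring V\<^esub>"
      by (intro bexI[of _ "- p"]) (simp_all add: poly_ring_def)
  next
    fix p q :: "'k mpoly"
    assume "p \<in> carrier (poly_ring V)" "q \<in> carrier (poly_ring V)"
    then show "p \<oplus>\<^bsub>poly_ring V\<^esub> q \<in> carrier (poly_ring V)"
      using keys_add[of p q] by (auto simp: poly_ring_def)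
  qed (auto simp: poly_ring_def algebra_simps)
  show "comm_monoid (poly_ring V :: 'k mpoly ring)"
  proof (rule comm_monoidI)
    fix p q :: "'k mpoly"
    assume pq: "p \<in> carrier (poly_ring V)" "q \<in> carrier (poly_ring V)"
    have "keys m \<subseteq> V" if m: "m \<in> keys (p * q)" for m
    proof -
      obtain a b where "a \<in> keys p" "b \<in> keys q" "m = a + b"
        using m keys_mult[of p q] by blast
      with pq show ?thesis
        using keys_add[of a b] unfolding poly_ring_def by fastforce
    qed
    then show "p \<otimes>\<^bsub>poly_ring V\<^esub> q \<in> carrier (poly_ring V)"
      by (auto simp: poly_ring_def)
  qed (auto simp: poly_ring_def algebra_simps)
qed (auto simp: poly_ring_def algebra_simps)


section \<open>Associated primes and normally torsion-free ideals\<close>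

text \<open>
  The primes of the form \<open>Ann\<^sub>R(z)\<close> with \<open>z \<in> R/I\<close>; the scalar \<open>a \<in> R\<close> acts on \<open>R/I\<close> as
  multiplication by its residue class.
\<close>

definition Ass_quot :: "('a, 'b) ring_scheme \<Rightarrow> 'a set \<Rightarrow> 'a set set" where
  "Ass_quot R I = {P. primeideal P R \<and>
     (\<exists>z\<in>carrier (R Quot I).
        P = {a \<in> carrier R. (I +>\<^bsub>R\<^esub> a) \<otimes>\<^bsub>R Quot I\<^esub> z = \<zero>\<^bsub>R Quot I\<^esub>})}"

definition ideal_power :: "('a, 'b) ring_scheme \<Rightarrow> 'a set \<Rightarrow> nat \<Rightarrow> 'a set" where
  "ideal_power R I t = I [^]\<^bsub>ideals_set R\<^esub> t"

definition normally_torsion_free :: "('a, 'b) ring_scheme \<Rightarrow> 'a set \<Rightarrow> bool" where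
  "normally_torsion_free R I \<longleftrightarrow> (\<forall>t\<ge>1. Ass_quot R (ideal_power R I t) = Ass_quot R I)"


section \<open>Square-free monomial ideals\<close>

definition squarefree_monomial_ideal :: "nat set \<Rightarrow> ('k::field) mpoly set \<Rightarrow> bool" where
  "squarefree_monomial_ideal V I \<longleftrightarrow>
     (\<exists>M. (\<forall>m\<in>M. keys m \<subseteq> V \<and> (\<forall>i. lookup m i \<le> 1)) \<and> I = Idl\<^bsub>poly_ring V\<^esub> (mon ` M))"

text \<open>
  The minimal monomial generators, as exponent vectors: the monomials of \<open>I\<close> that are
  not divisible by any other monomial of \<open>I\<close>.
\<close>

definition min_gens :: "('k::field) mpoly set \<Rightarrow> expo set" where
  "min_gens I = {m. mon m \<in> I \<and>
     (\<forall>n. mon n \<in> I \<longrightarrow> (\<forall>i. lookup n i \<le> lookup m i) \<longrightarrow> n = m)}"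

text \<open>
  For a square-free monomial ideal in finitely many variables \<open>min_gens I\<close> is finite, so this is
  the maximum of a finite set, which is nonempty because of \<open>S = {}\<close>. For the unit ideal, whose
  only minimal generator \<open>1\<close> has empty support, the value is 1; for the zero ideal it is 0.
\<close>

definition beta1 :: "('k::field) mpoly set \<Rightarrow> nat" where
  "beta1 I = Max {card S | S. S \<subseteq> min_gens I \<and> pairwise (\<lambda>m n. keys m \<inter> keys n = {}) S}"


section \<open>Minors\<close>

definition set_var :: "nat \<Rightarrow> 'k \<Rightarrow> ('k::field) mpoly \<Rightarrow> 'k mpoly" where
  "set_var x c p =
     (\<Sum>m\<in>keys p. Poly_Mapping.single (Poly_Mapping.update x 0 m) (lookup p m * c ^ lookup m x))"

lemma set_var_mon:
  "set_var x c (mon m) = Poly_Mapping.single (Poly_Mapping.update x 0 m) (c ^ lookup m x)"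
  by (simp add: set_var_def mon_def)

definition deletion :: "nat set \<Rightarrow> nat \<Rightarrow> ('k::field) mpoly set \<Rightarrow> 'k mpoly set" where
  "deletion V x I = Idl\<^bsub>poly_ring (V - {x})\<^esub> (set_var x 0 ` mon ` min_gens I)"

definition contraction :: "nat set \<Rightarrow> nat \<Rightarrow> ('k::field) mpoly set \<Rightarrow> 'k mpoly set" where
  "contraction V x I = Idl\<^bsub>poly_ring (V - {x})\<^esub> (set_var x 1 ` mon ` min_gens I)"

text \<open>An ideal is paired with the variable set of its polynomial ring.\<close>

inductive minor_step ::
  "nat set \<times> ('k::field) mpoly set \<Rightarrow> nat set \<times> 'k mpoly set \<Rightarrow> bool" where
  delete: "x \<in> V \<Longrightarrow> minor_step (V, I) (V - {x}, deletion V x I)"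
| contract: "x \<in> V \<Longrightarrow> minor_step (V, I) (V - {x}, contraction V x I)"

definition proper_minor ::
  "nat set \<Rightarrow> ('k::field) mpoly set \<Rightarrow> nat set \<Rightarrow> 'k mpoly set \<Rightarrow> bool" where
  "proper_minor V I W J \<longleftrightarrow> minor_step\<^sup>+\<^sup>+ (V, I) (W, J)"

end

theory Submission
  imports Defs
begin

text \<open>
  A witness for \<open>\<mm> \<in> Ass (R/I\<^sup>t)\<close> may be taken to be a monomial \<open>u \<notin> I\<^sup>t\<close> with \<open>x\<^sub>i u \<in> I\<^sup>t\<close> for
  all \<open>i\<close>. Suppose that some variable \<open>x\<close> does not divide \<open>u\<close>, and let \<open>J\<close> be the deletion of \<open>x\<close>.
  Then \<open>u\<close> also shows that the maximal homogeneous ideal \<open>\<nn>\<close> of the smaller ring is associated to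
  \<open>J\<^sup>t\<close>, hence to the square-free ideal \<open>J\<close>, so \<open>J = \<nn>\<close>. As \<open>I \<noteq> \<mm>\<close>, this forces \<open>I = \<nn>R\<close>, whose
  powers admit \<open>x\<close> as a nonzerodivisor, contradicting \<open>x u \<in> I\<^sup>t\<close>. So \<open>u\<close> is divisible by every
  variable, hence by the product of \<open>\<beta>\<^sub>1(I)\<close> pairwise coprime generators, and \<open>u \<notin> I\<^sup>t\<close> gives
  \<open>t > \<beta>\<^sub>1(I)\<close>.
\<close>

section \<open>Exponent vectors\<close>

text \<open>The exponents of all monomials in the ideal generated by the monomials with exponents in
  \<open>A\<close>. The variable set is left out here; it enters only through the carrier in
  \<open>monomial_ideal\<close>.\<close>

definition multiples :: "expo set \<Rightarrow> expo set" where
  "multiples A = {a + c | a c. a \<in> A}"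

text \<open>Exponents of the products of n generators, hence generators of the n-th power.\<close>

primrec sumset :: "expo set \<Rightarrow> nat \<Rightarrow> expo set" where
  "sumset A 0 = {0}"
| "sumset A (Suc n) = {s + a | s a. s \<in> sumset A n \<and> a \<in> A}"

lemma keys_plus_expo: "keys (a + b :: expo) = keys a \<union> keys b"
  by (auto simp: in_keys_iff lookup_add)

lemma expo_dvd_iff: "(\<exists>c. m = n + c) \<longleftrightarrow> (\<forall>i. lookup n i \<le> lookup m i)" for m n :: expo
proof
  assume "\<forall>i. lookup n i \<le> lookup m i"
  then have "m = n + (m - n)"
    by (intro poly_mapping_eqI) (simp add: lookup_add lookup_minus)
  then show "\<exists>c. m = n + c" ..
qed (auto simp: lookup_add)

lemma multiples_iff: "m \<in> multiples A \<longleftrightarrow> (\<exists>a\<in>A. \<forall>i. lookup a i \<le> lookup m i)"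
  unfolding multiples_def using expo_dvd_iff by blast

lemma multiples_plus: "m \<in> multiples A \<Longrightarrow> m + n \<in> multiples A"
  unfolding multiples_def by (auto simp: add.assoc) blast

lemma multiples_mono: "A \<subseteq> B \<Longrightarrow> multiples A \<subseteq> multiples B"
  by (auto simp: multiples_def)

lemma multiples_sumset_mono: "A \<subseteq> B \<Longrightarrow> multiples (sumset A n) \<subseteq> multiples (sumset B n)"
proof (rule multiples_mono)
  show "A \<subseteq> B \<Longrightarrow> sumset A n \<subseteq> sumset B n"
    by (induction n) auto
qed

text \<open>Powers of an ideal decrease: the last summand can be absorbed into the cofactor.\<close>

lemma multiples_sumset_le:
  assumes "m \<le> n"
  shows "multiples (sumset A n) \<subseteq> multiples (sumset A m)"
  using assms
proof (induction n rule: dec_induct)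
  case (step n)
  have "multiples (sumset A (Suc n)) \<subseteq> multiples (sumset A n)"
    unfolding multiples_def by (auto simp: add.assoc) blast
  with step.IH show ?case by blast
qed simp

lemma keys_sumset:
  assumes "\<And>a. a \<in> A \<Longrightarrow> keys a \<subseteq> V" "s \<in> sumset A n"
  shows "keys s \<subseteq> V"
  using assms(2)
proof (induction n arbitrary: s)
  case (Suc n)
  then obtain s' a where "s = s' + a" "s' \<in> sumset A n" "a \<in> A" by auto
  with Suc.IH assms(1) show ?case by (simp add: keys_plus_expo)
qed simp

lemma sum_in_sumset: "finite S \<Longrightarrow> S \<subseteq> A \<Longrightarrow> \<Sum>S \<in> sumset A (card S)"
proof (induction S rule: finite_induct)
  case (insert a S)
  then have "\<Sum>S + a \<in> sumset A (Suc (card S))" by auto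
  with insert show ?case by (simp add: add.commute)
qed simp

text \<open>Exponents are nonnegative, so supports cannot cancel in a sum and every summand avoids
  \<open>x\<close>.\<close>

lemma sumset_avoiding:
  assumes "s \<in> sumset A n" "x \<notin> keys s"
  shows "s \<in> sumset {a \<in> A. x \<notin> keys a} n"
  using assms
proof (induction n arbitrary: s)
  case (Suc n)
  then obtain s' a where "s = s' + a" "s' \<in> sumset A n" "a \<in> A" by auto
  with Suc show ?case by (auto simp: keys_plus_expo)
qed simp

text \<open>Passes from powers of an ideal to powers of its deletion: a divisor of a monomial free
  of \<open>x\<close> is free of \<open>x\<close> too.\<close>

lemma multiples_sumset_avoiding:
  assumes "m \<in> multiples (sumset A n)" "x \<notin> keys m"
  shows "m \<in> multiples (sumset {a \<in> A. x \<notin> keys a} n)"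
  using assms sumset_avoiding unfolding multiples_def
  by (fastforce simp: keys_plus_expo)

text \<open>The variable \<open>x\<close> is a nonzerodivisor modulo a monomial ideal whose
  generators do not involve it.\<close>

lemma multiples_cancel_var:
  assumes "u + Poly_Mapping.single x 1 \<in> multiples A" "\<And>a. a \<in> A \<Longrightarrow> x \<notin> keys a"
  shows "u \<in> multiples A"
proof -
  obtain a where a: "a \<in> A" "\<forall>i. lookup a i \<le> lookup (u + Poly_Mapping.single x 1) i"
    using assms(1) by (auto simp: multiples_iff)
  have "lookup a i \<le> lookup u i" for i
    using a(2)[rule_format, of i] assms(2)[OF a(1)]
    by (cases "i = x") (auto simp: lookup_add lookup_single_not_eq in_keys_iff)
  with a(1) show ?thesis by (auto simp: multiples_iff)
qed

lemma lookup_var_le: "i \<in> keys m \<Longrightarrow> lookup (Poly_Mapping.single i 1 :: expo) j \<le> lookup m j"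
  by (cases "i = j") (auto simp: lookup_single_not_eq in_keys_iff)

section \<open>Square-free exponent vectors\<close>

lemma squarefree_eqI:
  fixes m n :: expo
  assumes "\<forall>i. lookup m i \<le> 1" "\<forall>i. lookup n i \<le> 1" "keys m = keys n"
  shows "m = n"
proof (rule poly_mapping_eqI)
  fix i
  have "lookup m i = 0 \<longleftrightarrow> lookup n i = 0"
    using assms(3) by (metis in_keys_iff)
  then show "lookup m i = lookup n i"
    using assms(1,2)[rule_format, of i] by linarith
qed

lemma finite_squarefree:
  assumes "finite V"
  shows "finite {m :: expo. keys m \<subseteq> V \<and> (\<forall>i. lookup m i \<le> 1)}"
proof (rule inj_on_finite)
  show "inj_on keys {m :: expo. keys m \<subseteq> V \<and> (\<forall>i. lookup m i \<le> 1)}"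
    using squarefree_eqI by (auto intro!: inj_onI)
  show "keys ` {m :: expo. keys m \<subseteq> V \<and> (\<forall>i. lookup m i \<le> 1)} \<subseteq> Pow V" by auto
qed (use assms in simp)

text \<open>At each index at most one summand is nonzero, so a product of pairwise coprime
  square-free monomials is again square-free.\<close>

lemma sum_disjoint_squarefree_le:
  fixes S :: "expo set"
  assumes "finite S" "\<And>m i. m \<in> S \<Longrightarrow> lookup m i \<le> 1"
    and "pairwise (\<lambda>m n. keys m \<inter> keys n = {}) S"
  shows "lookup (\<Sum>S) i \<le> 1"
  using assms
proof (induction S rule: finite_induct)
  case (insert a S)
  have disj: "keys a \<inter> keys n = {}" if "n \<in> S" for n
    using insert.prems(2) insert.hyps that by (auto simp: pairwise_def)
  have IH: "lookup (\<Sum>S) i \<le> 1"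
    using insert.IH insert.prems by (auto simp: pairwise_insert)
  show ?case
  proof (cases "i \<in> keys a")
    case True
    then have "\<forall>n\<in>S. lookup n i = 0"
      using disj by (meson disjoint_iff in_keys_iff)
    then have "lookup (\<Sum>S) i = 0" by (simp add: lookup_sum)
    then show ?thesis
      using insert.hyps insert.prems(1)[of a i] by (simp add: lookup_add)
  next
    case False
    then show ?thesis
      using insert.hyps IH by (simp add: lookup_add in_keys_iff)
  qed
qed simp


section \<open>Monomial ideals\<close>

text \<open>Taking the termwise membership criterion as the definition turns questions about ideals
  into questions about exponents. \<open>genideal_mon\<close> identifies it with the generated ideal
  when \<open>A\<close> lives on \<open>V\<close>.\<close>

definition monomial_ideal :: "nat set \<Rightarrow> expo set \<Rightarrow> ('k::field) mpoly set" where
  "monomial_ideal V A = {p \<in> carrier (poly_ring V). keys p \<subseteq> multiples A}"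

lemma poly_ring_simps [simp]:
  "mult (poly_ring V) = (*)" "one (poly_ring V) = 1"
  "zero (poly_ring V) = 0" "add (poly_ring V) = (+)"
  by (simp_all add: poly_ring_def)

lemma poly_ring_carrier: "p \<in> carrier (poly_ring V) \<longleftrightarrow> (\<forall>m\<in>keys p. keys m \<subseteq> V)"
  by (simp add: poly_ring_def)

lemma ring_poly_ring: "ring (poly_ring V :: ('k::field) mpoly ring)"
  using cring_poly_ring by (rule cring.axioms(1))

lemma keys_mon [simp]: "keys (mon m :: ('k::field) mpoly) = {m}"
  by (simp add: mon_def)

lemma mon_in_monomial_ideal:
  "(mon m :: ('k::field) mpoly) \<in> monomial_ideal V A \<longleftrightarrow> keys m \<subseteq> V \<and> m \<in> multiples A"
  by (auto simp: monomial_ideal_def poly_ring_carrier)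

lemma sum_monomials: "(\<Sum>m\<in>keys p. Poly_Mapping.single m (lookup p m)) = p"
  by (rule poly_mapping_eqI) (simp add: lookup_sum lookup_single when_def in_keys_iff)

lemma lookup_times_mon: "lookup (p * mon u :: ('k::field) mpoly) (m + u) = lookup p m"
proof -
  have "p * mon u = (\<Sum>a\<in>keys p. Poly_Mapping.single (a + u) (lookup p a))"
    by (subst (1) sum_monomials[of p, symmetric])
      (simp add: mon_def sum_distrib_right mult_single)
  then show ?thesis
    by (simp add: lookup_sum lookup_single when_def in_keys_iff)
qed

lemma keys_times_mon: "keys (p * mon u :: ('k::field) mpoly) = (\<lambda>m. m + u) ` keys p"
proof
  show "keys (p * mon u) \<subseteq> (\<lambda>m. m + u) ` keys p"
    using keys_mult[of p "mon u"] by auto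
  show "(\<lambda>m. m + u) ` keys p \<subseteq> keys (p * mon u)"
    by (auto simp: in_keys_iff lookup_times_mon)
qed

text \<open>Only the pair of zero exponents sums to zero, so constant coefficients multiply. This
  makes \<open>max_hom_ideal\<close> prime.\<close>

lemma lookup_mult_0: "lookup (p * q :: ('k::field) mpoly) 0 = lookup p 0 * lookup q 0"
proof -
  \<comment> \<open>What remains of \<open>q\<close> without its constant term contributes nothing
    to the constant coefficient of the product.\<close>
  let ?q = "q - Poly_Mapping.single 0 (lookup q 0)"
  have "0 \<notin> keys ?q"
    by (simp add: in_keys_iff lookup_minus)
  moreover have "a + b = 0 \<longleftrightarrow> a = 0 \<and> b = 0" for a b :: expo
    by (metis Un_empty keys_eq_empty keys_plus_expo)
  ultimately have "0 \<notin> keys (p * ?q)"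
    using keys_mult[of p ?q] by fastforce
  moreover have "p * q = p * Poly_Mapping.single 0 (lookup q 0) + p * ?q"
    by (simp add: algebra_simps)
  \<comment> \<open>With the constant on the left, the product is coefficientwise scaling.\<close>
  moreover have "p * Poly_Mapping.single 0 (lookup q 0) = Poly_Mapping.single 0 (lookup q 0) * p"
    by (rule mult.commute)
  ultimately show ?thesis
    by (simp add: lookup_add in_keys_iff flip: mult_map_scale_conv_mult)
       (simp add: map.rep_eq when_def)
qed

lemma ideal_monomial_ideal: "ideal (monomial_ideal V A :: ('k::field) mpoly set) (poly_ring V)"
proof -
  interpret R: cring "poly_ring V :: 'k mpoly ring" by (rule cring_poly_ring)
  have mult: "p * q \<in> monomial_ideal V A"
    if p: "p \<in> monomial_ideal V A" and q: "q \<in> carrier (poly_ring V)" for p q :: "'k mpoly"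
  proof -
    have "p * q \<in> carrier (poly_ring V)"
      using R.m_closed[of p q] p q by (simp add: monomial_ideal_def)
    moreover have "keys (p * q) \<subseteq> multiples A"
      using keys_mult[of p q] p multiples_plus unfolding monomial_ideal_def by fastforce
    ultimately show ?thesis by (simp add: monomial_ideal_def)
  qed
  show ?thesis
  proof (rule idealI)
    show "subgroup (monomial_ideal V A) (add_monoid (poly_ring V :: 'k mpoly ring))"
    proof (rule R.add.subgroupI)
      show "monomial_ideal V A \<subseteq> carrier (poly_ring V)"
        by (auto simp: monomial_ideal_def)
      have "0 \<in> monomial_ideal V A"
        by (simp add: monomial_ideal_def poly_ring_carrier)
      then show "monomial_ideal V A \<noteq> {}" by blast
      fix p q :: "'k mpoly"
      assume p: "p \<in> monomial_ideal V A"
      have "- 1 \<in> carrier (poly_ring V :: 'k mpoly ring)"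
        by (simp add: poly_ring_carrier)
      then have neg: "- p \<in> monomial_ideal V A"
        using mult[OF p, of "- 1"] by simp
      have "p \<in> carrier (poly_ring V)" "- p \<in> carrier (poly_ring V)"
        using p neg by (simp_all add: monomial_ideal_def)
      then have "\<ominus>\<^bsub>poly_ring V\<^esub> p = - p"
        by (intro R.minus_equality) simp_all
      then show "\<ominus>\<^bsub>poly_ring V\<^esub> p \<in> monomial_ideal V A"
        using neg by simp
      assume q: "q \<in> monomial_ideal V A"
      have "p + q \<in> carrier (poly_ring V)"
        using R.a_closed[of p q] p q by (simp add: monomial_ideal_def)
      moreover have "keys (p + q) \<subseteq> multiples A"
        using p q keys_add[of p q] by (auto simp: monomial_ideal_def)
      ultimately show "p \<oplus>\<^bsub>poly_ring V\<^esub> q \<in> monomial_ideal V A"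
        by (simp add: monomial_ideal_def)
    qed
  next
    fix p q :: "'k mpoly"
    assume "p \<in> monomial_ideal V A" "q \<in> carrier (poly_ring V)"
    then have "p * q \<in> monomial_ideal V A" by (rule mult)
    then show "q \<otimes>\<^bsub>poly_ring V\<^esub> p \<in> monomial_ideal V A"
      "p \<otimes>\<^bsub>poly_ring V\<^esub> q \<in> monomial_ideal V A"
      by (simp_all add: mult.commute)
  qed (rule ring_poly_ring)
qed

section \<open>Generators, products and powers of monomial ideals\<close>

lemma ideal_termwise:
  fixes K :: "('k::field) mpoly set"
  assumes "ideal K (poly_ring V)"
    and "\<And>m. m \<in> keys p \<Longrightarrow> Poly_Mapping.single m (lookup p m) \<in> K"
  shows "p \<in> K"
proof -
  have "(\<Sum>m\<in>F. Poly_Mapping.single m (lookup p m)) \<in> K" if "finite F" "F \<subseteq> keys p" for F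
    using that
  proof (induction F rule: finite_induct)
    case empty
    show ?case using additive_subgroup.zero_closed[OF ideal.axioms(1)[OF assms(1)]] by simp
  next
    case (insert m F)
    then show ?case
      using additive_subgroup.a_closed[OF ideal.axioms(1)[OF assms(1)]] assms(2)[of m] by simp
  qed
  from this[of "keys p"] show ?thesis
    by (simp add: sum_monomials)
qed

lemma monomial_ideal_subset:
  fixes K :: "('k::field) mpoly set"
  assumes K: "ideal K (poly_ring V)" and "mon ` A \<subseteq> K"
  shows "monomial_ideal V A \<subseteq> K"
proof
  fix p :: "'k mpoly" assume p: "p \<in> monomial_ideal V A"
  show "p \<in> K"
  proof (rule ideal_termwise[OF K])
    fix m assume m: "m \<in> keys p"
    then obtain a c where ac: "a \<in> A" "m = a + c" and V: "keys m \<subseteq> V"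
      using p by (auto simp: monomial_ideal_def multiples_def poly_ring_carrier)
    have "Poly_Mapping.single c (lookup p m) \<in> carrier (poly_ring V)"
      using V ac by (auto simp: poly_ring_carrier keys_plus_expo)
    then have "mon a * Poly_Mapping.single c (lookup p m) \<in> K"
      using ideal.I_r_closed[OF K, of "mon a"] assms(2) ac(1) by auto
    then show "Poly_Mapping.single m (lookup p m) \<in> K"
      by (simp add: mon_def mult_single ac(2))
  qed
qed

text \<open>The set \<open>S\<close> may contain more than the monomials themselves: the generating
  set of a deletion also contains 0 when some generator is divisible by the deleted
  variable.\<close>

lemma genideal_eq_monomial_ideal:
  fixes S :: "('k::field) mpoly set"
  assumes "mon ` A \<subseteq> S" "S \<subseteq> monomial_ideal V A"
  shows "Idl\<^bsub>poly_ring V\<^esub> S = monomial_ideal V A"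
proof
  interpret R: ring "poly_ring V :: 'k mpoly ring" by (rule ring_poly_ring)
  show "Idl\<^bsub>poly_ring V\<^esub> S \<subseteq> monomial_ideal V A"
    using ideal_monomial_ideal assms(2) by (rule R.genideal_minimal)
  have "S \<subseteq> carrier (poly_ring V)"
    using assms(2) by (auto simp: monomial_ideal_def)
  then show "monomial_ideal V A \<subseteq> Idl\<^bsub>poly_ring V\<^esub> S"
    using R.genideal_ideal R.genideal_self assms(1) by (intro monomial_ideal_subset) blast+
qed

lemma self_in_multiples: "a \<in> A \<Longrightarrow> a \<in> multiples A"
  by (auto simp: multiples_iff)

lemma genideal_mon:
  assumes "\<And>a. a \<in> A \<Longrightarrow> keys a \<subseteq> V"
  shows "Idl\<^bsub>poly_ring V\<^esub> (mon ` A :: ('k::field) mpoly set) = monomial_ideal V A"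
  using assms by (intro genideal_eq_monomial_ideal) (auto simp: mon_in_monomial_ideal self_in_multiples)

lemma ideal_prod_monomial_ideal:
  assumes "\<And>a. a \<in> A \<Longrightarrow> keys a \<subseteq> V" "\<And>b. b \<in> B \<Longrightarrow> keys b \<subseteq> V"
  shows "ideal_prod (poly_ring V) (monomial_ideal V A) (monomial_ideal V B) =
    (monomial_ideal V {a + b | a b. a \<in> A \<and> b \<in> B} :: ('k::field) mpoly set)" (is "?L = ?R")
proof
  interpret R: ring "poly_ring V :: 'k mpoly ring" by (rule ring_poly_ring)
  show "?L \<subseteq> ?R"
  proof
    fix p assume "p \<in> ?L"
    then show "p \<in> ?R"
    proof induction
      case (prod p q)
      have "p * q \<in> carrier (poly_ring V)"
        using R.m_closed[of p q] prod by (simp add: monomial_ideal_def)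
      moreover have "m \<in> multiples {a + b | a b. a \<in> A \<and> b \<in> B}" if "m \<in> keys (p * q)" for m
      proof -
        obtain m1 m2 where m: "m = m1 + m2" "m1 \<in> multiples A" "m2 \<in> multiples B"
          using \<open>m \<in> keys (p * q)\<close> keys_mult[of p q] prod
          unfolding monomial_ideal_def by blast
        then obtain a b c e where "a \<in> A" "b \<in> B" "m = (a + b) + (c + e)"
          by (auto simp: multiples_def ac_simps)
        then show ?thesis by (auto simp: multiples_def)
      qed
      ultimately show ?case by (auto simp: monomial_ideal_def)
    next
      case (sum p q)
      then show ?case
        using additive_subgroup.a_closed[OF ideal.axioms(1)[OF ideal_monomial_ideal]] by blast
    qed
  qed
  show "?R \<subseteq> ?L"
  proof (rule monomial_ideal_subset)
    show "ideal ?L (poly_ring V)"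
      by (intro R.ideal_prod_is_ideal ideal_monomial_ideal)
    have "mon (a + b) \<in> ?L" if "a \<in> A" "b \<in> B" for a b
    proof -
      have "(mon a :: 'k mpoly) \<in> monomial_ideal V A" "(mon b :: 'k mpoly) \<in> monomial_ideal V B"
        using assms that by (auto simp: mon_in_monomial_ideal self_in_multiples)
      then have "mon a \<otimes>\<^bsub>poly_ring V\<^esub> mon b \<in> ?L" by (rule ideal_prod.prod)
      then show ?thesis by (simp add: mon_def mult_single)
    qed
    then show "mon ` {a + b | a b. a \<in> A \<and> b \<in> B} \<subseteq> ?L" by auto
  qed
qed

lemma ideal_power_monomial_ideal:
  assumes "\<And>a. a \<in> A \<Longrightarrow> keys a \<subseteq> V"
  shows "ideal_power (poly_ring V) (monomial_ideal V A) n =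
    (monomial_ideal V (sumset A n) :: ('k::field) mpoly set)"
proof (induction n)
  case 0
  \<comment> \<open>The zeroth power is the whole ring, matching the single generator 1.\<close>
  have "m \<in> multiples {0}" for m
    by (auto simp: multiples_def)
  then show ?case
    by (auto simp: ideal_power_def ideals_set_def monomial_ideal_def)
next
  case (Suc n)
  have "ideal_power (poly_ring V) (monomial_ideal V A) (Suc n) =
    ideal_prod (poly_ring V) (ideal_power (poly_ring V) (monomial_ideal V A) n)
      (monomial_ideal V A :: 'k mpoly set)"
    by (simp add: ideal_power_def ideals_set_def)
  also have "\<dots> = monomial_ideal V (sumset A (Suc n))"
    unfolding Suc.IH using keys_sumset[OF assms] assms
    by (subst ideal_prod_monomial_ideal) auto
  finally show ?case .
qed

section \<open>The maximal homogeneous ideal\<close>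

lemma mem_max_hom_ideal_iff:
  "(p :: ('k::field) mpoly) \<in> max_hom_ideal V \<longleftrightarrow> p \<in> carrier (poly_ring V) \<and> 0 \<notin> keys p"
proof -
  let ?X = "(\<lambda>i. Poly_Mapping.single i 1 :: expo) ` V"
  have "max_hom_ideal V = (Idl\<^bsub>poly_ring V\<^esub> (mon ` ?X) :: 'k mpoly set)"
    by (simp add: max_hom_ideal_def image_image)
  also have "\<dots> = monomial_ideal V ?X"
    by (intro genideal_mon) auto
  finally have *: "(max_hom_ideal V :: 'k mpoly set) = monomial_ideal V ?X" .
  have "m \<in> multiples ?X \<longleftrightarrow> m \<noteq> 0" if V: "keys m \<subseteq> V" for m
  proof
    assume "m \<noteq> 0"
    then obtain i where "i \<in> keys m" by (metis all_not_in_conv keys_eq_empty)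
    with V show "m \<in> multiples ?X"
      using lookup_var_le unfolding multiples_iff by blast
  next
    show "m \<in> multiples ?X \<Longrightarrow> m \<noteq> 0"
      by (force simp: multiples_iff)
  qed
  then show ?thesis
    unfolding * monomial_ideal_def by (auto simp: poly_ring_carrier subset_iff)
qed

lemma primeideal_max_hom_ideal: "primeideal (max_hom_ideal V :: ('k::field) mpoly set) (poly_ring V)"
proof (rule primeidealI)
  interpret R: ring "poly_ring V :: 'k mpoly ring" by (rule ring_poly_ring)
  show "ideal (max_hom_ideal V :: 'k mpoly set) (poly_ring V)"
    unfolding max_hom_ideal_def by (rule R.genideal_ideal) (auto simp: poly_ring_carrier)
  have "(1 :: 'k mpoly) \<in> carrier (poly_ring V)" "(1 :: 'k mpoly) \<notin> max_hom_ideal V"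
    by (simp_all add: poly_ring_carrier mem_max_hom_ideal_iff)
  then show "carrier (poly_ring V :: 'k mpoly ring) \<noteq> max_hom_ideal V" by blast
qed (auto simp: mem_max_hom_ideal_iff in_keys_iff lookup_mult_0 cring_poly_ring)


section \<open>Associated primes\<close>

text \<open>Choosing a representative \<open>w\<close> of the coset turns the annihilator in the
  quotient into the colon ideal I : w.\<close>

lemma Ass_quot_iff:
  assumes "ideal I R"
  shows "P \<in> Ass_quot R I \<longleftrightarrow>
    primeideal P R \<and> (\<exists>w\<in>carrier R. P = {a \<in> carrier R. a \<otimes>\<^bsub>R\<^esub> w \<in> I})"
proof -
  interpret ideal I R by fact
  have "(I +>\<^bsub>R\<^esub> a) \<otimes>\<^bsub>R Quot I\<^esub> (I +>\<^bsub>R\<^esub> w) = \<zero>\<^bsub>R Quot I\<^esub> \<longleftrightarrow> a \<otimes>\<^bsub>R\<^esub> w \<in> I"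
    if "a \<in> carrier R" "w \<in> carrier R" for a w
  proof -
    have "I +>\<^bsub>R\<^esub> (a \<otimes>\<^bsub>R\<^esub> w) = I \<longleftrightarrow> a \<otimes>\<^bsub>R\<^esub> w \<in> I"
      using rcos_const_imp_mem[OF m_closed[OF that]] a_rcos_const by blast
    then show ?thesis
      using that by (simp add: FactRing_def rcoset_mult_add)
  qed
  then have "{a \<in> carrier R. (I +>\<^bsub>R\<^esub> a) \<otimes>\<^bsub>R Quot I\<^esub> (I +>\<^bsub>R\<^esub> w) = \<zero>\<^bsub>R Quot I\<^esub>} =
    {a \<in> carrier R. a \<otimes>\<^bsub>R\<^esub> w \<in> I}" if "w \<in> carrier R" for w
    using that by blast
  moreover have "carrier (R Quot I) = (\<lambda>w. I +>\<^bsub>R\<^esub> w) ` carrier R"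
    unfolding FactRing_simps by auto
  ultimately show ?thesis
    unfolding Ass_quot_def by (simp only: mem_Collect_eq bex_simps(7) cong: bex_cong)
qed

text \<open>Multiplication by a variable shifts the terms of a polynomial without cancellation.
  Hence any term of a witness that lies outside the ideal is, up to its coefficient, itself a
  witness.\<close>

lemma max_hom_ideal_in_Ass_iff:
  "max_hom_ideal V \<in> Ass_quot (poly_ring V) (monomial_ideal V A :: ('k::field) mpoly set) \<longleftrightarrow>
    (\<exists>u. keys u \<subseteq> V \<and> u \<notin> multiples A \<and> (\<forall>i\<in>V. u + Poly_Mapping.single i 1 \<in> multiples A))"
    (is "?L \<longleftrightarrow> ?R")
proof
  let ?m = "max_hom_ideal V :: 'k mpoly set" and ?I = "monomial_ideal V A :: 'k mpoly set"
  assume ?L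
  then obtain w :: "'k mpoly" where w: "w \<in> carrier (poly_ring V)"
    and ann: "?m = {a \<in> carrier (poly_ring V). a * w \<in> ?I}"
    unfolding Ass_quot_iff[OF ideal_monomial_ideal] by auto
  have "1 \<in> carrier (poly_ring V)" "1 \<notin> ?m"
    by (simp_all add: poly_ring_carrier mem_max_hom_ideal_iff)
  then have "w \<notin> ?I" using ann by auto
  then obtain u where u: "u \<in> keys w" "u \<notin> multiples A"
    using w by (auto simp: monomial_ideal_def)
  have "u + Poly_Mapping.single i 1 \<in> multiples A" if "i \<in> V" for i
  proof -
    have "mon (Poly_Mapping.single i 1) \<in> ?m"
      using that by (simp add: mem_max_hom_ideal_iff poly_ring_carrier flip: keys_eq_empty)
    then have "w * mon (Poly_Mapping.single i 1) \<in> ?I"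
      using ann by (simp add: mult.commute)
    then show ?thesis
      using u(1) by (auto simp: monomial_ideal_def keys_times_mon)
  qed
  then show ?R
    using u w by (auto simp: poly_ring_carrier)
next
  let ?m = "max_hom_ideal V :: 'k mpoly set" and ?I = "monomial_ideal V A :: 'k mpoly set"
  interpret R: ring "poly_ring V :: 'k mpoly ring" by (rule ring_poly_ring)
  assume ?R
  then obtain u where u: "keys u \<subseteq> V" "u \<notin> multiples A"
    and mult: "\<And>i. i \<in> V \<Longrightarrow> u + Poly_Mapping.single i 1 \<in> multiples A" by blast
  \<comment> \<open>A nonconstant monomial contains some variable, which already sends
    \<open>u\<close> into the ideal.\<close>
  have nz: "m + u \<in> multiples A" if m: "keys m \<subseteq> V" "m \<noteq> 0" for m
  proof -
    obtain i where i: "i \<in> keys m" using m(2) by (metis all_not_in_conv keys_eq_empty)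
    then obtain c where "m = Poly_Mapping.single i 1 + c"
      using expo_dvd_iff lookup_var_le by metis
    then have "m + u = (u + Poly_Mapping.single i 1) + c" by (simp add: ac_simps)
    then show ?thesis using multiples_plus mult i m(1) by auto
  qed
  have mon: "(mon u :: 'k mpoly) \<in> carrier (poly_ring V)"
    using u(1) by (simp add: poly_ring_carrier)
  have "p \<in> ?m \<longleftrightarrow> p * mon u \<in> ?I" if p: "p \<in> carrier (poly_ring V)" for p :: "'k mpoly"
  proof -
    have "p * mon u \<in> carrier (poly_ring V)"
      using R.m_closed[OF p mon] by simp
    \<comment> \<open>The constant term of \<open>p\<close> shifts to \<open>u\<close>, which is not
      a multiple; by \<open>nz\<close> every other term shifts to a multiple.\<close>
    moreover have "keys (p * mon u) \<subseteq> multiples A \<longleftrightarrow> 0 \<notin> keys p"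
      using nz u(2) p by (force simp: keys_times_mon poly_ring_carrier)
    ultimately show ?thesis
      using p by (simp add: mem_max_hom_ideal_iff monomial_ideal_def)
  qed
  then have "?m = {a \<in> carrier (poly_ring V). a \<otimes>\<^bsub>poly_ring V\<^esub> mon u \<in> ?I}"
    by (auto simp: mem_max_hom_ideal_iff)
  then show ?L
    unfolding Ass_quot_iff[OF ideal_monomial_ideal]
    by (intro conjI primeideal_max_hom_ideal bexI[OF _ mon])
qed

text \<open>A radical ideal with associated prime \<open>\<mm>\<close> is \<open>\<mm>\<close> itself.\<close>

lemma squarefree_max_hom_ideal_in_Ass:
  assumes sf: "\<And>a i. a \<in> A \<Longrightarrow> lookup a i \<le> 1"
    and "max_hom_ideal V \<in> Ass_quot (poly_ring V) (monomial_ideal V A :: ('k::field) mpoly set)"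
    and "i \<in> V"
  shows "Poly_Mapping.single i 1 \<in> A"
proof -
  obtain u where uV: "keys u \<subseteq> V" and u: "u \<notin> multiples A"
    and mult: "\<And>i. i \<in> V \<Longrightarrow> u + Poly_Mapping.single i 1 \<in> multiples A"
    using assms(2) unfolding max_hom_ideal_in_Ass_iff by metis
  \<comment> \<open>If x_j already divides \<open>u\<close>, a further factor x_j cannot make
    \<open>u\<close> divisible by a new square-free generator.\<close>
  have "u = 0"
  proof (rule ccontr)
    assume "u \<noteq> 0"
    then obtain j where j: "j \<in> keys u" by (metis all_not_in_conv keys_eq_empty)
    then obtain a where a: "a \<in> A" "\<forall>i. lookup a i \<le> lookup (u + Poly_Mapping.single j 1) i"
      using mult uV unfolding multiples_iff by blast
    have "lookup a i \<le> lookup u i" for i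
      using a(2)[rule_format, of i] sf[OF a(1), of i] j
      by (cases "i = j") (auto simp: lookup_add lookup_single_not_eq in_keys_iff)
    with a(1) u show False by (auto simp: multiples_iff)
  qed
  \<comment> \<open>Now 1 is outside the ideal but x_i is inside, so the generator dividing x_i must
    be x_i itself.\<close>
  then obtain a where a: "a \<in> A" "\<forall>j. lookup a j \<le> lookup (Poly_Mapping.single i 1) j"
    using mult[OF \<open>i \<in> V\<close>] unfolding multiples_iff by auto
  have "a \<noteq> 0" using a(1) u self_in_multiples \<open>u = 0\<close> by blast
  moreover have "keys a \<subseteq> {i}"
    using a(2) by (metis in_keys_iff insertCI le_zero_eq lookup_single_not_eq subsetI)
  ultimately have "keys a = {i}" by (metis keys_eq_empty subset_singletonD)
  then have "a = Poly_Mapping.single i 1"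
    using sf[OF a(1)] by (intro squarefree_eqI) (auto simp: lookup_single when_def)
  with a(1) show ?thesis by simp
qed


section \<open>Square-free monomial ideals\<close>

text \<open>The given generating set \<open>M\<close> may be redundant. The minimal generators lie
  in \<open>M\<close>, which gives their support and square-freeness, and every element of
  \<open>M\<close> is divisible by one of them.\<close>

lemma squarefree_min_gens:
  fixes I :: "('k::field) mpoly set"
  assumes "squarefree_monomial_ideal V I"
  shows "I = monomial_ideal V (min_gens I)"
    and "m \<in> min_gens I \<Longrightarrow> keys m \<subseteq> V"
    and "m \<in> min_gens I \<Longrightarrow> lookup m i \<le> 1"
proof -
  obtain M where M: "\<And>m. m \<in> M \<Longrightarrow> keys m \<subseteq> V" "\<And>m i. m \<in> M \<Longrightarrow> lookup m i \<le> 1"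
    and "I = Idl\<^bsub>poly_ring V\<^esub> (mon ` M)"
    using assms unfolding squarefree_monomial_ideal_def by blast
  then have I: "I = monomial_ideal V M"
    using genideal_mon by metis
  have mem: "mon n \<in> I \<longleftrightarrow> keys n \<subseteq> V \<and> (\<exists>m\<in>M. \<forall>i. lookup m i \<le> lookup n i)" for n
    by (simp add: I mon_in_monomial_ideal multiples_iff)
  have sub: "min_gens I \<subseteq> M"
  proof
    fix g assume "g \<in> min_gens I"
    then have g: "mon g \<in> I" "\<And>n. mon n \<in> I \<Longrightarrow> \<forall>i. lookup n i \<le> lookup g i \<Longrightarrow> n = g"
      by (auto simp: min_gens_def)
    from g(1) obtain m where m: "m \<in> M" "\<forall>i. lookup m i \<le> lookup g i"
      by (auto simp: mem)
    moreover from m(1) have "mon m \<in> I" using M(1) by (auto simp: mem)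
    ultimately show "g \<in> M" using g(2) by blast
  qed
  have "m \<in> multiples (min_gens I)" if m: "m \<in> M" for m
  proof -
    \<comment> \<open>For square-free monomials divisibility is inclusion of supports, so a divisor
      of \<open>m\<close> in \<open>M\<close> with smallest support is minimal.\<close>
    obtain g where g: "g \<in> M \<and> keys g \<subseteq> keys m"
      and min: "\<And>n. n \<in> M \<and> keys n \<subseteq> keys m \<Longrightarrow> card (keys g) \<le> card (keys n)"
      using ex_has_least_nat[of "\<lambda>n. n \<in> M \<and> keys n \<subseteq> keys m" m "\<lambda>n. card (keys n)"] m by blast
    \<comment> \<open>Minimality is required against all monomials of \<open>I\<close>, not just
      those in \<open>M\<close>; an element \<open>a\<close> of \<open>M\<close> dividing
      \<open>n\<close> is squeezed between.\<close>
    have "n = g" if n: "mon n \<in> I" "\<forall>i. lookup n i \<le> lookup g i" for n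
    proof -
      obtain a where a: "a \<in> M" "\<forall>i. lookup a i \<le> lookup n i"
        using n(1) by (auto simp: mem)
      have ag: "lookup a i \<le> lookup g i" for i
        using a(2) n(2) le_trans by blast
      then have sub: "keys a \<subseteq> keys g"
        by (metis in_keys_iff le_zero_eq subsetI)
      then have "card (keys g) \<le> card (keys a)"
        using a(1) g by (intro min) blast
      then have "keys a = keys g"
        using sub by (simp add: card_seteq)
      then have "a = g"
        using M(2) a(1) g by (intro squarefree_eqI) auto
      then show "n = g"
        using a(2) n(2) by (intro poly_mapping_eqI) (simp add: le_antisym)
    qed
    moreover have "mon g \<in> I" using g M(1) by (auto simp: mem)
    ultimately have "g \<in> min_gens I" by (auto simp: min_gens_def)
    moreover have "lookup g i \<le> lookup m i" for i
    proof (cases "i \<in> keys g")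
      case True
      with g have "lookup m i \<noteq> 0" by (auto simp: in_keys_iff subset_iff)
      with M(2)[of g i] g show ?thesis by linarith
    qed (simp add: in_keys_iff)
    ultimately show ?thesis by (auto simp: multiples_iff)
  qed
  then have "multiples M = multiples (min_gens I)"
    using multiples_mono[OF sub] multiples_plus by (auto simp: multiples_def[of M])
  then show "I = monomial_ideal V (min_gens I)"
    by (subst I) (simp add: monomial_ideal_def)
  show "m \<in> min_gens I \<Longrightarrow> keys m \<subseteq> V" "m \<in> min_gens I \<Longrightarrow> lookup m i \<le> 1"
    using sub M by auto
qed

lemma deletion_eq_monomial_ideal:
  fixes I :: "('k::field) mpoly set"
  assumes "squarefree_monomial_ideal V I"
  shows "deletion V x I = monomial_ideal (V - {x}) {m \<in> min_gens I. x \<notin> keys m}"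
  unfolding deletion_def
proof (rule genideal_eq_monomial_ideal)
  let ?B = "{m \<in> min_gens I. x \<notin> keys m}"
  \<comment> \<open>The monomial survives with coefficient 1 because 0 ^ 0 = 1.\<close>
  have upd: "set_var x 0 (mon m) = (mon m :: 'k mpoly)" if "x \<notin> keys m" for m
  proof -
    have "lookup m x = 0" using that by (simp add: in_keys_iff)
    moreover from this have "Poly_Mapping.update x 0 m = m"
      by (intro poly_mapping_eqI) (auto simp: lookup_update)
    ultimately show ?thesis unfolding set_var_mon by (simp add: mon_def)
  qed
  then show "mon ` ?B \<subseteq> set_var x (0::'k) ` mon ` min_gens I"
    by (force simp: image_iff)
  have "set_var x 0 (mon m) \<in> (monomial_ideal (V - {x}) ?B :: 'k mpoly set)"
    if m: "m \<in> min_gens I" for m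
  proof (cases "x \<in> keys m")
    \<comment> \<open>The positive power of 0 makes the image the zero polynomial.\<close>
    case True
    then show ?thesis
      by (simp add: set_var_mon in_keys_iff monomial_ideal_def poly_ring_carrier)
  next
    case False
    then show ?thesis
      using m squarefree_min_gens(2)[OF assms m]
      by (auto simp: upd mon_in_monomial_ideal self_in_multiples)
  qed
  then show "set_var x 0 ` mon ` min_gens I \<subseteq> (monomial_ideal (V - {x}) ?B :: 'k mpoly set)"
    by auto
qed

text \<open>The maximum is taken over a finite set, since there are finitely many square-free
  exponents on \<open>V\<close>, and a nonempty one, since the empty family qualifies.\<close>

lemma beta1_attained:
  fixes I :: "('k::field) mpoly set"
  assumes "squarefree_monomial_ideal V I" "finite V"
  obtains S where "S \<subseteq> min_gens I" "finite S" "pairwise (\<lambda>m n. keys m \<inter> keys n = {}) S"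
    "card S = beta1 I"
proof -
  have fin: "finite (min_gens I)"
    using squarefree_min_gens(2,3)[OF assms(1)]
    by (intro finite_subset[OF _ finite_squarefree[OF assms(2)]]) auto
  let ?C = "{card S | S. S \<subseteq> min_gens I \<and> pairwise (\<lambda>m n. keys m \<inter> keys n = {}) S}"
  have "finite ?C"
    by (rule finite_subset[of _ "card ` Pow (min_gens I)"]) (use fin in auto)
  moreover have "?C \<noteq> {}"
    by (auto intro: exI[of _ "{}"])
  ultimately have "beta1 I \<in> ?C"
    unfolding beta1_def by (rule Max_in)
  then obtain S where S: "S \<subseteq> min_gens I" "pairwise (\<lambda>m n. keys m \<inter> keys n = {}) S"
    "card S = beta1 I"
    by auto
  with finite_subset[OF S(1) fin] show ?thesis using that by blast
qed

section \<open>Comparison of a socle monomial with the deletion of a variable\<close>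

lemma witness_divisible_by_var:
  fixes I :: "('k::field) mpoly set"
  assumes I: "squarefree_monomial_ideal V I" and "I \<noteq> max_hom_ideal V" and "t \<ge> 1"
    and ntf: "normally_torsion_free (poly_ring (V - {x})) (deletion V x I)"
    and u: "keys u \<subseteq> V" "u \<notin> multiples (sumset (min_gens I) t)"
    and mult: "\<And>i. i \<in> V \<Longrightarrow> u + Poly_Mapping.single i 1 \<in> multiples (sumset (min_gens I) t)"
    and "x \<in> V"
  shows "x \<in> keys u"
proof (rule ccontr)
  assume x: "x \<notin> keys u"
  let ?G = "min_gens I"
  let ?B = "{m \<in> ?G. x \<notin> keys m}"
  let ?J = "monomial_ideal (V - {x}) ?B :: 'k mpoly set"
  note GV = squarefree_min_gens(2)[OF I] and sf = squarefree_min_gens(3)[OF I]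
  have J: "deletion V x I = ?J" by (rule deletion_eq_monomial_ideal[OF I])
  \<comment> \<open>Since i differs from \<open>x\<close>, the product is still free of
    \<open>x\<close>, so only generators of the deletion can occur in it.\<close>
  have "u + Poly_Mapping.single i 1 \<in> multiples (sumset ?B t)" if "i \<in> V - {x}" for i
    using that x by (intro multiples_sumset_avoiding mult) (auto simp: keys_plus_expo)
  moreover have "u \<notin> multiples (sumset ?B t)"
    using u(2) multiples_sumset_mono[of ?B ?G t] by blast
  ultimately have "max_hom_ideal (V - {x}) \<in> Ass_quot (poly_ring (V - {x}))
      (monomial_ideal (V - {x}) (sumset ?B t) :: 'k mpoly set)"
    using u(1) x unfolding max_hom_ideal_in_Ass_iff by blast
  also have "monomial_ideal (V - {x}) (sumset ?B t) = ideal_power (poly_ring (V - {x})) ?J t"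
    using GV by (subst ideal_power_monomial_ideal) auto
  also have "Ass_quot (poly_ring (V - {x})) \<dots> = Ass_quot (poly_ring (V - {x})) ?J"
    using ntf \<open>t \<ge> 1\<close> unfolding normally_torsion_free_def J by blast
  finally have vars: "Poly_Mapping.single y 1 \<in> ?G" if "y \<in> V - {x}" for y
    using squarefree_max_hom_ideal_in_Ass[of ?B] sf that by blast
  have minimal: "n = g" if "g \<in> ?G" "n \<in> ?G" "\<forall>i. lookup n i \<le> lookup g i" for g n
    using that unfolding min_gens_def by blast
  \<comment> \<open>If 1 were a generator, the t-th power would be the whole ring and contain
    \<open>u\<close>.\<close>
  have zero: "0 \<notin> ?G"
  proof
    assume "0 \<in> ?G"
    then have "0 \<in> sumset ?G t" by (induction t) force+
    with u(2) show False by (auto simp: multiples_iff)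
  qed
  show False
  \<comment> \<open>All other variables are generators. Either \<open>x\<close> is one too and
    \<open>I\<close> is the maximal ideal, or no generator involves \<open>x\<close>.\<close>
  proof (cases "Poly_Mapping.single x 1 \<in> ?G")
    case True
    have "m \<in> multiples ?G \<longleftrightarrow> m \<noteq> 0" if V: "keys m \<subseteq> V" for m
    proof
      assume "m \<noteq> 0"
      then obtain i where i: "i \<in> keys m" by (metis all_not_in_conv keys_eq_empty)
      with V True vars have "Poly_Mapping.single i 1 \<in> ?G" by blast
      with i show "m \<in> multiples ?G"
        using lookup_var_le multiples_iff by blast
    next
      assume "m \<in> multiples ?G"
      with zero show "m \<noteq> 0"
        by (metis le_zero_eq lookup_zero multiples_iff poly_mapping_eqI)
    qed
    then have "p \<in> monomial_ideal V ?G \<longleftrightarrow> p \<in> max_hom_ideal V" for p :: "'k mpoly"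
      unfolding mem_max_hom_ideal_iff monomial_ideal_def
      by (auto simp: poly_ring_carrier subset_iff)
    then have "I = max_hom_ideal V"
      using squarefree_min_gens(1)[OF I] by blast
    with \<open>I \<noteq> max_hom_ideal V\<close> show False ..
  next
    case False
    \<comment> \<open>A generator divisible by \<open>x\<close> but different from \<open>x\<close>
      would be divisible by another variable y; as y is a generator, minimality gives g = y.\<close>
    have "x \<notin> keys g" if g: "g \<in> ?G" for g
    proof
      assume xg: "x \<in> keys g"
      have "keys g \<noteq> {x}"
      proof
        assume "keys g = {x}"
        then have "g = Poly_Mapping.single x 1"
          using sf[OF g] by (intro squarefree_eqI) (auto simp: lookup_single when_def)
        with False g show False by simp
      qed
      with xg obtain y where y: "y \<in> keys g" "y \<noteq> x" by blast
      then have "Poly_Mapping.single y 1 \<in> ?G"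
        using vars GV[OF g] by blast
      then have "Poly_Mapping.single y 1 = g"
        using minimal[OF g] lookup_var_le[OF y(1)] by blast
      with xg y(2) show False by auto
    qed
    then have "x \<notin> keys s" if "s \<in> sumset ?G t" for s
      using that keys_sumset[of ?G "- {x}" s t] by blast
    then have "u \<in> multiples (sumset ?G t)"
      using mult[OF \<open>x \<in> V\<close>] multiples_cancel_var by blast
    with u(2) show False ..
  qed
qed

text \<open>The maximal ideal has to be excluded when d is positive: its proper minors are generated
  by all remaining variables or are the unit ideal, and it is associated to itself at t = 1, while
  its \<open>beta1\<close> is d.\<close>

theorem corollary3p6:
  fixes I :: "('k::field) mpoly set" and d t :: nat
  assumes "squarefree_monomial_ideal {1..d} I"
    and "I \<noteq> max_hom_ideal {1..d}"
    and "\<And>W J. proper_minor {1..d} I W J \<Longrightarrow> normally_torsion_free (poly_ring W) J"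
    and "t \<ge> 1"
    and "max_hom_ideal {1..d} \<in> Ass_quot (poly_ring {1..d}) (ideal_power (poly_ring {1..d}) I t)"
  shows "t \<ge> beta1 I + 1"
proof (rule ccontr)
  let ?V = "{1..d}" and ?G = "min_gens I"
  assume "\<not> t \<ge> beta1 I + 1"
  then have t: "t \<le> beta1 I" by simp
  note sf = squarefree_min_gens[OF assms(1)]
  have power: "ideal_power (poly_ring ?V) I t = monomial_ideal ?V (sumset ?G t)"
    using sf(2) by (subst sf(1)) (rule ideal_power_monomial_ideal)
  obtain u where u: "keys u \<subseteq> ?V" "u \<notin> multiples (sumset ?G t)"
    and mult: "\<And>i. i \<in> ?V \<Longrightarrow> u + Poly_Mapping.single i 1 \<in> multiples (sumset ?G t)"
    using assms(5) unfolding power max_hom_ideal_in_Ass_iff by metis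
  have full: "x \<in> keys u" if x: "x \<in> ?V" for x
  proof (rule witness_divisible_by_var[OF assms(1,2,4) _ u mult x])
    have "proper_minor ?V I (?V - {x}) (deletion ?V x I)"
      unfolding proper_minor_def using minor_step.delete[OF x] by blast
    then show "normally_torsion_free (poly_ring (?V - {x})) (deletion ?V x I)"
      by (rule assms(3))
  qed
  obtain S where S: "S \<subseteq> ?G" "finite S" "pairwise (\<lambda>m n. keys m \<inter> keys n = {}) S"
    "card S = beta1 I"
    using beta1_attained[OF assms(1)] by blast
  have sum: "\<Sum>S \<in> sumset ?G (beta1 I)"
    using sum_in_sumset[OF S(2,1)] S(4) by simp
  have "lookup (\<Sum>S) i \<le> lookup u i" for i
  proof (cases "i \<in> ?V")
    case True
    \<comment> \<open>The product over a maximum matching is square-free with support in the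
      variable set, and \<open>u\<close> has exponent at least 1 at every variable, so the product
      divides \<open>u\<close>.\<close>
    have "lookup (\<Sum>S) i \<le> 1"
      using S sf(3) by (intro sum_disjoint_squarefree_le) auto
    also have "1 \<le> lookup u i"
      using full[OF True] by (simp add: in_keys_iff)
    finally show ?thesis .
  next
    case False
    then have "i \<notin> keys (\<Sum>S)"
      using keys_sumset[OF sf(2) sum] by blast
    then show ?thesis by (simp add: in_keys_iff)
  qed
  then have "u \<in> multiples (sumset ?G (beta1 I))"
    using sum by (auto simp: multiples_iff)
  with u(2) multiples_sumset_le[OF t] show False by blast
qed

end
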